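(* Let $G$ be a graph with maximum degree $\Delta$. Suppose that every vertex of $G$ has degree at least $\frac{c\Delta}{\ln^{\epsilon}\Delta}$, for some $\epsilon \geq 0$, where $c$ is a positive constant. Then $\chi_{ON}(G) = O(\ln^{1+\epsilon}\Delta)$.
   Context: A conflict-free open neighborhood (CFON) coloring of $G$ is an assignment of colors to $V(G)$ such that for every vertex $v$ some color appears exactly once in the open neighborhood $N_G(v)$; $\chi_{ON}(G)$ is the minimum number of colors in such a coloring. The implied constant in $O(\cdot)$ may depend on $c$ (and $\epsilon$). *)

theory Defs
  imports Complex_Main "HOL-Library.Extended_Real" "Graph_Theory.Pair_Digraph"
begin

text \<open>
  A finite simple graph is a \<^locale>\<open>pair_graph\<close>: a finite vertex set together with a
  symmetric, irreflexive set of arcs; the edge \<open>uv\<close> is the pair of arcs \<open>(u, v)\<close>, \<open>(v, u)\<close>.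
\<close>

definition open_neighborhood :: "'a pair_pre_digraph \<Rightarrow> 'a \<Rightarrow> 'a set" where
  "open_neighborhood G v = {w. (v, w) \<in> parcs G}"

definition vertex_degree :: "'a pair_pre_digraph \<Rightarrow> 'a \<Rightarrow> nat" where
  "vertex_degree G v = card (open_neighborhood G v)"

text \<open>The maximum degree of the graph without vertices is taken to be \<open>0\<close>.\<close>

definition max_degree :: "'a pair_pre_digraph \<Rightarrow> nat" where
  "max_degree G = Max (insert 0 (vertex_degree G ` pverts G))"

definition cfon_coloring :: "'a pair_pre_digraph \<Rightarrow> ('a \<Rightarrow> nat) \<Rightarrow> bool" where
  "cfon_coloring G f \<longleftrightarrow>
     (\<forall>v \<in> pverts G. \<exists>c. \<exists>!w. w \<in> open_neighborhood G v \<and> f w = c)"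

text \<open>
  The value is \<open>\<infinity>\<close> if there is no such coloring, i.e. if \<open>G\<close> has an isolated vertex. Otherwise
  the infimum is attained, as it ranges over natural numbers.
\<close>

definition chi_ON :: "'a pair_pre_digraph \<Rightarrow> enat" where
  "chi_ON G = (INF f \<in> {f. cfon_coloring G f}. enat (card (f ` pverts G)))"

end

theory Submission
  imports Defs "HOL-Real_Asymp.Real_Asymp"
begin

text \<open>
  Give every vertex one of \<open>\<Delta>\<close> raw colors uniformly at random, keep \<open>k \<approx> (7 e / c) ln\<^sup>1\<^sup>+\<^sup>\<epsilon> \<Delta>\<close> of
  them and merge all others into one dummy color. A neighborhood of size \<open>n \<le> \<Delta>\<close> contains no uniquely
  occurring kept color with probability at most \<open>e n exp (- k n / (e \<Delta>)) \<le> e \<Delta>\<^sup>-\<^sup>6\<close>, and such an event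
  depends on at most \<open>\<Delta>\<^sup>2\<close> others, so the local lemma applies. If \<open>k\<close> exceeds \<open>\<Delta>\<close>, then \<open>\<Delta>\<close> is bounded
  in terms of \<open>c\<close> and \<open>\<epsilon>\<close>, and a greedy coloring that is injective on every neighborhood suffices.
\<close>

section \<open>Words in which no special letter occurs exactly once\<close>

text \<open>In the application \<open>A\<close> is a neighborhood and \<open>K\<close> the set of
  kept colors. A value outside \<open>K\<close> that occurs once does not count, since all those
  values get merged into one color.\<close>

definition no_unique :: "'a set \<Rightarrow> 'b set \<Rightarrow> ('a \<Rightarrow> 'b) \<Rightarrow> bool" where
  "no_unique A K f \<longleftrightarrow> (\<forall>s\<in>K. card {x \<in> A. f x = s} \<noteq> 1)"

lemma power_le_fact_exp:
  fixes x :: real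
  assumes "x \<ge> 0"
  shows "x ^ n \<le> fact n * exp x"
proof -
  have "x ^ n / fact n \<le> (\<Sum>k. x ^ k / fact k)"
    using sum_le_suminf[of "\<lambda>k. x ^ k / fact k" "{n}"] summable_exp[of x] assms
    by (simp add: divide_inverse mult.commute)
  also have "\<dots> = exp x"
    by (simp add: exp_def divide_inverse mult.commute)
  finally show ?thesis by (simp add: field_simps)
qed

text \<open>A letter that may occur any number of times except once has the exponential generating
  function e^x - x; truncating the series drops nonnegative terms only.\<close>

lemma sum_exp_without_linear_term_le:
  fixes r :: real
  assumes "r \<ge> 0"
  shows "(\<Sum>j\<in>{..n} - {1}. r ^ j / fact j) \<le> exp r - r"
proof -
  have "(\<Sum>j\<in>insert 1 ({..n} - {1}). r ^ j / fact j) \<le> (\<Sum>j. r ^ j / fact j)"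
    using summable_exp[of r] assms
    by (intro sum_le_suminf) (auto simp: divide_inverse mult.commute)
  also have "\<dots> = exp r"
    by (simp add: exp_def divide_inverse mult.commute)
  finally show ?thesis by (simp del: insert_Diff_single)
qed

lemma sum_Pow_by_card:
  fixes h :: "nat \<Rightarrow> real"
  assumes "finite A"
  shows "(\<Sum>J\<in>{J \<in> Pow A. card J \<noteq> m}. h (card J)) = (\<Sum>j\<in>{..card A} - {m}. (card A choose j) * h j)"
proof -
  have "(\<Sum>J\<in>{J \<in> Pow A. card J \<noteq> m}. h (card J)) =
      (\<Sum>j\<in>{..card A} - {m}. \<Sum>J\<in>{J \<in> {J \<in> Pow A. card J \<noteq> m}. card J = j}. h (card J))"
    by (rule sum.group[symmetric]) (use assms in \<open>auto intro: card_mono\<close>)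
  also have "\<dots> = (\<Sum>j\<in>{..card A} - {m}. (card A choose j) * h j)"
  proof (rule sum.cong)
    fix j assume j: "j \<in> {..card A} - {m}"
    then have "{J \<in> {J \<in> Pow A. card J \<noteq> m}. card J = j} = {J. J \<subseteq> A \<and> card J = j}" by auto
    then show "(\<Sum>J\<in>{J \<in> {J \<in> Pow A. card J \<noteq> m}. card J = j}. h (card J)) = (card A choose j) * h j"
      using n_subsets[OF assms, of j] by simp
  qed simp
  finally show ?thesis .
qed

text \<open>
  The exponential generating function of these words is
  \<open>(e\<^sup>x - x)\<^sup>k e\<^sup>m\<^sup>x\<close>, and a coefficient of a power series with nonnegative coefficients is at most
  its value at \<open>r\<close> divided by the corresponding power of \<open>r\<close>.
\<close>

lemma card_no_unique_le:
  fixes r :: real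
  assumes "finite K" "finite D" "K \<inter> D = {}" "finite A" "r > 0"
  shows "card {f \<in> A \<rightarrow>\<^sub>E (K \<union> D). no_unique A K f}
           \<le> fact (card A) / r ^ card A * (exp r - r) ^ card K * exp (card D * r)"
  using assms
proof (induction K arbitrary: A rule: finite_induct)
  case empty
  \<comment> \<open>Without special letters every word over \<open>D\<close> counts, and their
    number is estimated by one term of the series of exp (|D| r).\<close>
  have "card {f \<in> A \<rightarrow>\<^sub>E ({} \<union> D). no_unique A {} f} = card D ^ card A"
    using empty by (simp add: no_unique_def card_funcsetE)
  moreover have "(card D * r) ^ card A \<le> fact (card A) * exp (card D * r)"
    using empty by (intro power_le_fact_exp) auto
  ultimately show ?case
    using \<open>r > 0\<close> by (simp add: field_simps)
next
  case (insert s K)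
  let ?S = "\<lambda>A. {f \<in> A \<rightarrow>\<^sub>E (K \<union> D). no_unique A K f}"
  let ?T = "{f \<in> A \<rightarrow>\<^sub>E (insert s K \<union> D). no_unique A (insert s K) f}"
  let ?P = "{J \<in> Pow A. card J \<noteq> 1}"
  let ?X = "(exp r - r) ^ card K * exp (card D * r)"
  let ?n = "card A"
  \<comment> \<open>A word is determined by the set \<open>J\<close> of positions of
    \<open>s\<close> and by its restriction to the other positions, which again contains no letter
    of \<open>K\<close> exactly once. As \<open>s\<close> is special, \<open>J\<close> is not a
    singleton.\<close>
  define \<phi> where "\<phi> f = ({x \<in> A. f x = s}, restrict f {x \<in> A. f x \<noteq> s})" for f :: "'b \<Rightarrow> 'a"
  have exp_ge: "exp r - r \<ge> 0"
    using exp_ge_add_one_self[of r] by linarith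
  have fin: "finite (?S J)" if "J \<subseteq> A" for J
    using that insert.prems insert.hyps by (auto intro!: finite_PiE finite_subset[OF that])
  have "inj_on \<phi> ?T"
  proof (rule inj_onI)
    fix f g assume f: "f \<in> ?T" and g: "g \<in> ?T" and eq: "\<phi> f = \<phi> g"
    show "f = g"
    proof
      fix x
      have 1: "{x \<in> A. f x = s} = {x \<in> A. g x = s}"
        and 2: "restrict f {x \<in> A. f x \<noteq> s} x = restrict g {x \<in> A. g x \<noteq> s} x"
        using eq by (auto simp: \<phi>_def)
      show "f x = g x"
      proof (cases "x \<in> A")
        case True
        then have "f x = s \<longleftrightarrow> g x = s" using 1 by blast
        then show ?thesis using 2 True by (cases "f x = s") auto
      next
        case False
        then show ?thesis using f g by (auto simp: PiE_def extensional_def)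
      qed
    qed
  qed
  moreover have "\<phi> ` ?T \<subseteq> (SIGMA J:?P. ?S (A - J))"
  proof
    fix y assume "y \<in> \<phi> ` ?T"
    then obtain f where f: "f \<in> ?T" and y: "y = \<phi> f" by blast
    let ?J = "{x \<in> A. f x = s}"
    have AJ: "A - ?J = {x \<in> A. f x \<noteq> s}" by auto
    have "?J \<in> ?P" using f by (auto simp: no_unique_def)
    moreover have "restrict f (A - ?J) \<in> (A - ?J) \<rightarrow>\<^sub>E (K \<union> D)"
      using f by (auto simp: PiE_def Pi_def)
    moreover have "no_unique (A - ?J) K (restrict f (A - ?J))"
      unfolding no_unique_def
    proof
      fix t assume t: "t \<in> K"
      then have "{x \<in> A - ?J. restrict f (A - ?J) x = t} = {x \<in> A. f x = t}"
        using insert.hyps by auto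
      then show "card {x \<in> A - ?J. restrict f (A - ?J) x = t} \<noteq> 1"
        using f t by (auto simp: no_unique_def)
    qed
    moreover have "y = (?J, restrict f (A - ?J))"
      unfolding y \<phi>_def AJ ..
    ultimately show "y \<in> (SIGMA J:?P. ?S (A - J))" by blast
  qed
  moreover have "finite (SIGMA J:?P. ?S (A - J))"
    using insert.prems by (intro finite_SigmaI fin) auto
  ultimately have "card ?T \<le> card (SIGMA J:?P. ?S (A - J))"
    by (rule card_inj_on_le)
  also have "\<dots> = (\<Sum>J\<in>?P. card (?S (A - J)))"
    using insert.prems by (intro card_SigmaI ballI fin) auto
  finally have "real (card ?T) \<le> (\<Sum>J\<in>?P. real (card (?S (A - J))))"
    unfolding of_nat_sum[symmetric] of_nat_le_iff .
  also have "\<dots> \<le> (\<Sum>J\<in>?P. fact (?n - card J) / r ^ (?n - card J) * ?X)"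
  proof (rule sum_mono)
    fix J assume J: "J \<in> ?P"
    then have "finite J" "card (A - J) = ?n - card J"
      using insert.prems finite_subset[of J A] by (auto simp: card_Diff_subset)
    then show "real (card (?S (A - J))) \<le> fact (?n - card J) / r ^ (?n - card J) * ?X"
      using insert.IH[of "A - J"] insert.prems by (simp add: mult.assoc)
  qed
  also have "\<dots> = (\<Sum>j\<in>{..?n} - {1}. (?n choose j) * (fact (?n - j) / r ^ (?n - j) * ?X))"
    using insert.prems by (intro sum_Pow_by_card) auto
  \<comment> \<open>The binomial coefficient turns (n - j)! into n! / j!, which leaves a partial sum
    of the series of exp r without its linear term.\<close>
  also have "\<dots> = (\<Sum>j\<in>{..?n} - {1}. fact ?n / r ^ ?n * ?X * (r ^ j / fact j))"
  proof (rule sum.cong)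
    fix j assume "j \<in> {..?n} - {1}"
    then have j: "j \<le> ?n" by simp
    have "r ^ ?n = r ^ j * r ^ (?n - j)"
      using j by (simp flip: power_add)
    then show "(?n choose j) * (fact (?n - j) / r ^ (?n - j) * ?X) = fact ?n / r ^ ?n * ?X * (r ^ j / fact j)"
      using \<open>r > 0\<close> binomial_fact[OF j, where 'a = real] by (simp add: field_simps)
  qed simp
  also have "\<dots> = fact ?n / r ^ ?n * ?X * (\<Sum>j\<in>{..?n} - {1}. r ^ j / fact j)"
    by (rule sum_distrib_left[symmetric])
  also have "\<dots> \<le> fact ?n / r ^ ?n * ?X * (exp r - r)"
    using \<open>r > 0\<close> exp_ge by (intro mult_left_mono sum_exp_without_linear_term_le) auto
  also have "\<dots> = fact ?n / r ^ ?n * (exp r - r) ^ card (insert s K) * exp (card D * r)"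
    using insert.hyps by simp
  finally show ?case .
qed

text \<open>A weak form of Stirling's formula; the induction step amounts to e <= (1 + 1/n)^(n +
  1).\<close>

lemma fact_times_exp_le:
  assumes "n \<ge> 1"
  shows "fact n * exp (real n) \<le> exp 1 * real n * real n ^ n"
  using assms
proof (induction n rule: dec_induct)
  case base
  then show ?case by simp
next
  case (step n)
  have n: "real n > 0" using step by simp
  have "exp 1 \<le> (1 + 1 / real n) ^ (n + 1)"
  proof -
    \<comment> \<open>The bound on e is ln x <= x - 1 at x = n / (n + 1).\<close>
    have "ln (real n / (n + 1)) \<le> real n / (n + 1) - 1"
      using n by (intro ln_le_minus_one) auto
    also have "\<dots> = - 1 / (n + 1)" using n by (simp add: field_simps)
    finally have "1 \<le> (n + 1) * ln (1 + 1 / real n)"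
      using n by (simp add: ln_div field_simps)
    then have "exp 1 \<le> exp ((n + 1) * ln (1 + 1 / real n))" by (simp only: exp_le_cancel_iff)
    also have "\<dots> = (1 + 1 / real n) ^ (n + 1)"
      using n by (subst exp_of_nat_mult) (simp add: add_pos_pos)
    finally show ?thesis .
  qed
  then have e: "exp 1 * real n ^ (n + 1) \<le> (real n + 1) ^ (n + 1)"
    using n by (simp add: power_divide field_simps flip: power_Suc)
  have "fact (Suc n) * exp (real (Suc n)) = (real n + 1) * exp 1 * (fact n * exp (real n))"
    by (simp add: exp_add)
  also have "\<dots> \<le> (real n + 1) * exp 1 * (exp 1 * real n * real n ^ n)"
    using step by (intro mult_left_mono) auto
  also have "\<dots> = (real n + 1) * exp 1 * (exp 1 * real n ^ (n + 1))" by simp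
  also have "\<dots> \<le> (real n + 1) * exp 1 * (real n + 1) ^ (n + 1)"
    using e by (intro mult_left_mono) auto
  finally show ?case by (simp add: mult_ac add.commute)
qed

text \<open>With n = \<open>card A\<close>, the choice r = n / M minimizes exp (M r) / r^n, and
  Stirling leaves only a factor e n beyond M^n. Each kept color contributes e^r - r instead of e^r,
  which saves a factor exp (- r / e).\<close>

lemma card_no_unique_le_uniform:
  assumes "finite A" "A \<noteq> {}" "card A \<le> M" "k \<le> M"
  shows "card {f \<in> A \<rightarrow>\<^sub>E {..<M}. no_unique A {..<k} f}
           \<le> real M ^ card A * (exp 1 * card A * exp (- (real k * card A / (M * exp 1))))"
proof -
  let ?n = "card A"
  define r where "r = real ?n / M"
  have n: "?n \<ge> 1" using assms by (simp add: Suc_leI card_gt_0_iff)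
  then have M: "M \<ge> 1" using assms by linarith
  have r: "r > 0" "r \<le> 1" using n M assms by (auto simp: r_def field_simps)
  have split: "{..<k} \<union> {k..<M} = {..<M}" "{..<k} \<inter> {k..<M} = {}" using assms by auto
  have "r \<le> exp r" using exp_ge_add_one_self[of r] by linarith
  have "exp r - r = exp r * (1 - r * exp (- r))"
    by (simp add: exp_minus field_simps)
  also have "\<dots> \<le> exp r * exp (- (r * exp (- r)))"
    using exp_ge_add_one_self[of "- (r * exp (- r))"] by (intro mult_left_mono) auto
  \<comment> \<open>Here \<open>r \<le> 1\<close>, which comes from \<open>card A \<le> M\<close>,
    gives exp (- r) >= 1 / e.\<close>
  also have "\<dots> \<le> exp r * exp (- (r / exp 1))"
    using r by (simp add: exp_minus field_simps)
  finally have base: "exp r - r \<le> exp r * exp (- (r / exp 1))" .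
  have "card {f \<in> A \<rightarrow>\<^sub>E {..<M}. no_unique A {..<k} f}
      \<le> fact ?n / r ^ ?n * (exp r - r) ^ k * exp ((M - k) * r)"
    using card_no_unique_le[of "{..<k}" "{k..<M}" A r] assms r split
    by (simp add: of_nat_diff)
  also have "\<dots> \<le> fact ?n / r ^ ?n * (exp r * exp (- (r / exp 1))) ^ k * exp ((M - k) * r)"
    using r base \<open>r \<le> exp r\<close> by (intro mult_right_mono mult_left_mono power_mono) auto
  also have "\<dots> = fact ?n / r ^ ?n * exp (M * r) * exp (- (k * r / exp 1))"
    using assms by (simp add: of_nat_diff power_mult_distrib algebra_simps
        flip: exp_of_nat_mult exp_add)
  also have "\<dots> = real M ^ ?n * (fact ?n * exp ?n) / ?n ^ ?n * exp (- (k * r / exp 1))"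
    using M n by (simp add: r_def power_divide)
  also have "\<dots> \<le> real M ^ ?n * (exp 1 * ?n * real ?n ^ ?n) / ?n ^ ?n * exp (- (k * r / exp 1))"
    using fact_times_exp_le[OF n] by (intro mult_right_mono divide_right_mono mult_left_mono) auto
  finally show ?thesis
    using n by (simp add: r_def mult_ac)
qed

section \<open>The local lemma on a uniform product space\<close>

text \<open>Plays the part of measurability with respect to the coordinates in \<open>N\<close>.
  Complements within \<open>\<Omega>\<close> are of the same kind, since \<open>f\<close> and
  \<open>g\<close> may be interchanged.\<close>

definition determined_by :: "'a set \<Rightarrow> ('a \<Rightarrow> 'b) set \<Rightarrow> ('a \<Rightarrow> 'b) set \<Rightarrow> bool" where
  "determined_by N \<Omega> B \<longleftrightarrow> (\<forall>f\<in>\<Omega>. \<forall>g\<in>\<Omega>. (\<forall>x\<in>N. f x = g x) \<longrightarrow> f \<in> B \<longrightarrow> g \<in> B)"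

text \<open>Independence, by exchanging the coordinates in \<open>N\<close> of a pair of functions.\<close>

lemma card_Int_determined_by:
  fixes V :: "'a set" and K :: "'b set"
  defines "\<Omega> \<equiv> V \<rightarrow>\<^sub>E K"
  assumes "A \<subseteq> \<Omega>" "B \<subseteq> \<Omega>" "determined_by N \<Omega> A" "determined_by (- N) \<Omega> B"
  shows "card \<Omega> * card (A \<inter> B) = card A * card B"
proof -
  define m :: "('a \<Rightarrow> 'b) \<Rightarrow> ('a \<Rightarrow> 'b) \<Rightarrow> 'a \<Rightarrow> 'b"
    where "m f g x = (if x \<in> N then f x else g x)" for f g x
  \<comment> \<open>\<open>\<sigma>\<close> exchanges the two functions on \<open>N\<close>. If the
    second one lies in both \<open>A\<close> and \<open>B\<close>, the first image agrees with it on
    \<open>N\<close> and so lies in \<open>A\<close>, the second image agrees with it off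
    \<open>N\<close> and so lies in \<open>B\<close>.\<close>
  define \<sigma> where "\<sigma> = (\<lambda>(f, g). (m g f, m f g))"
  have m\<Omega>: "m f g \<in> \<Omega>" if "f \<in> \<Omega>" "g \<in> \<Omega>" for f g
    using that by (auto simp: m_def \<Omega>_def PiE_def Pi_def extensional_def)
  have A: "m f g \<in> A" if "f \<in> A" "g \<in> \<Omega>" for f g
  proof -
    have "\<forall>x\<in>N. f x = m f g x" by (simp add: m_def)
    moreover have "f \<in> \<Omega>" using assms(2) that by blast
    ultimately show ?thesis using assms(4) m\<Omega> that unfolding determined_by_def by blast
  qed
  have B: "m g f \<in> B" if "f \<in> B" "g \<in> \<Omega>" for f g
  proof -
    have "\<forall>x\<in>- N. f x = m g f x" by (simp add: m_def)
    moreover have "f \<in> \<Omega>" using assms(3) that by blast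
    ultimately show ?thesis using assms(5) m\<Omega> that unfolding determined_by_def by blast
  qed
  have inv: "\<sigma> (\<sigma> p) = p" for p
    by (cases p) (auto simp: \<sigma>_def m_def fun_eq_iff)
  have "bij_betw \<sigma> (\<Omega> \<times> (A \<inter> B)) (A \<times> B)"
  proof (rule bij_betwI[where g = \<sigma>])
    show "\<sigma> \<in> \<Omega> \<times> (A \<inter> B) \<rightarrow> A \<times> B"
    proof
      fix p assume "p \<in> \<Omega> \<times> (A \<inter> B)"
      then show "\<sigma> p \<in> A \<times> B" using A B by (cases p) (simp add: \<sigma>_def)
    qed
    have "m f g \<in> A \<inter> B" "m g f \<in> \<Omega>" if "f \<in> A" "g \<in> B" for f g
      using A B m\<Omega> that assms(2,3) by blast+
    then show "\<sigma> \<in> A \<times> B \<rightarrow> \<Omega> \<times> (A \<inter> B)"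
      by (simp add: \<sigma>_def Pi_def split: prod.split)
  qed (use inv in auto)
  then have "card (\<Omega> \<times> (A \<inter> B)) = card (A \<times> B)"
    by (rule bij_betw_same_card)
  then show ?thesis by (simp add: card_cartesian_product)
qed

text \<open>
  Probabilities are quotients of cardinalities. The induction shows that, given the absence of any set
  of other bad events, a bad event has conditional probability at most \<open>1 / (2 D)\<close>.
\<close>

lemma local_lemma:
  fixes V :: "'a set" and K :: "'b set" and N :: "'i \<Rightarrow> 'a set" and B :: "'i \<Rightarrow> ('a \<Rightarrow> 'b) set"
  defines "\<Omega> \<equiv> V \<rightarrow>\<^sub>E K"
  assumes fin: "finite V" "finite K" "finite I" and ne: "K \<noteq> {}"
    and B: "\<And>i. i \<in> I \<Longrightarrow> B i \<subseteq> \<Omega>" "\<And>i. i \<in> I \<Longrightarrow> determined_by (N i) \<Omega> (B i)"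
    and prob: "\<And>i. i \<in> I \<Longrightarrow> 4 * D * card (B i) \<le> card \<Omega>"
    and deg: "\<And>i. i \<in> I \<Longrightarrow> card {j \<in> I. N j \<inter> N i \<noteq> {}} \<le> D"
    and D: "D \<ge> 1"
  shows "\<exists>f\<in>\<Omega>. \<forall>i\<in>I. f \<notin> B i"
proof -
  define av where "av S = \<Omega> - (\<Union>i\<in>S. B i)" for S
  have fin\<Omega>: "finite \<Omega>" using fin by (simp add: \<Omega>_def finite_PiE)
  have finav: "finite (av S)" for S using fin\<Omega> by (simp add: av_def)
  have \<Omega>pos: "card \<Omega> > 0"
    using ne fin by (simp add: \<Omega>_def card_funcsetE card_gt_0_iff)
  \<comment> \<open>The conditional probability bound is cleared of denominators, so that it makes
    sense before \<open>av S\<close> is known to be nonempty.\<close>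
  have key: "2 * D * card (B i \<inter> av S) \<le> card (av S)" if "S \<subseteq> I" "i \<in> I" for S i
  proof -
    have "finite S" using that fin finite_subset by blast
    then show ?thesis using that
    proof (induction S arbitrary: i rule: finite_psubset_induct)
      case (psubset S)
      \<comment> \<open>\<open>S1\<close> collects the at most \<open>D\<close> events that share
        coordinates with \<open>B i\<close>; avoiding those in \<open>S2\<close> is independent of
        \<open>B i\<close>.\<close>
      define S1 where "S1 = {j \<in> S. N j \<inter> N i \<noteq> {}}"
      define S2 where "S2 = S - S1"
      have S: "S1 \<subseteq> I" "S2 \<subseteq> I" "S = S1 \<union> S2" "finite S1"
        using psubset.prems psubset.hyps by (auto simp: S1_def S2_def)
      have "S1 \<subseteq> {j \<in> I. N j \<inter> N i \<noteq> {}}" using psubset.prems by (auto simp: S1_def)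
      then have cS1: "card S1 \<le> D"
        using deg[OF psubset.prems(2)] fin card_mono[of "{j \<in> I. N j \<inter> N i \<noteq> {}}" S1] by simp
      have sub: "av S2 \<subseteq> av S \<union> (\<Union>j\<in>S1. B j \<inter> av S2)"
        using S by (auto simp: av_def)
      have "card (av S2) \<le> card (av S \<union> (\<Union>j\<in>S1. B j \<inter> av S2))"
        using S finav by (intro card_mono sub) auto
      also have "\<dots> \<le> card (av S) + card (\<Union>j\<in>S1. B j \<inter> av S2)"
        by (rule card_Un_le)
      also have "\<dots> \<le> card (av S) + (\<Sum>j\<in>S1. card (B j \<inter> av S2))"
        using S by (intro add_left_mono card_UN_le) auto
      finally have "2 * D * card (av S2) \<le> 2 * D * card (av S) + (\<Sum>j\<in>S1. 2 * D * card (B j \<inter> av S2))"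
        by (metis add_mult_distrib2 mult_le_mono2 sum_distrib_left)
      also have "(\<Sum>j\<in>S1. 2 * D * card (B j \<inter> av S2)) \<le> (\<Sum>j\<in>S1. card (av S2))"
      proof (rule sum_mono)
        fix j assume j: "j \<in> S1"
        \<comment> \<open>A member of \<open>S1\<close> makes \<open>S2\<close> a proper subset of
          \<open>S\<close>, as the induction hypothesis requires; for empty \<open>S1\<close> the
          sum has no terms.\<close>
        then have "S2 \<subset> S" by (auto simp: S1_def S2_def)
        then show "2 * D * card (B j \<inter> av S2) \<le> card (av S2)"
          using psubset.IH S j by blast
      qed
      also have "\<dots> \<le> D * card (av S2)" using cS1 by simp
      \<comment> \<open>Given \<open>av S2\<close>, each of the at most \<open>D\<close> events of
        \<open>S1\<close> has probability at most 1 / (2 D), so all of them are avoided with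
        probability at least 1/2.\<close>
      finally have half: "card (av S2) \<le> 2 * card (av S)"
        using D by (simp add: algebra_simps)
      have "determined_by (- N i) \<Omega> (av S2)"
        unfolding determined_by_def
      proof (intro ballI impI)
        fix f g assume fg: "f \<in> \<Omega>" "g \<in> \<Omega>" "\<forall>x\<in>- N i. f x = g x" "f \<in> av S2"
        show "g \<in> av S2"
        proof (rule ccontr)
          assume "g \<notin> av S2"
          then obtain j where j: "j \<in> S2" "g \<in> B j" using fg by (auto simp: av_def)
          then have "N j \<inter> N i = {}" by (auto simp: S1_def S2_def)
          then have "\<forall>x\<in>N j. g x = f x" using fg(3) by (metis ComplI IntI empty_iff)
          then have "f \<in> B j" using B(2)[of j] j fg S unfolding determined_by_def by blast
          then show False using fg j by (auto simp: av_def)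
        qed
      qed
      then have indep: "card \<Omega> * card (B i \<inter> av S2) = card (B i) * card (av S2)"
        unfolding \<Omega>_def
        by (intro card_Int_determined_by) (use B psubset.prems in \<open>auto simp: \<Omega>_def av_def\<close>)
      \<comment> \<open>By independence \<open>B i\<close> has probability at most 1 / (4 D) given
        \<open>av S2\<close>; passing to \<open>av S\<close> loses at most the factor 2 from
        \<open>half\<close>.\<close>
      have "card \<Omega> * (4 * D * card (B i \<inter> av S2)) = (4 * D * card (B i)) * card (av S2)"
        using indep by (simp add: algebra_simps)
      also have "\<dots> \<le> card \<Omega> * card (av S2)"
        using prob[OF psubset.prems(2)] by (intro mult_le_mono1)
      finally have "4 * D * card (B i \<inter> av S2) \<le> card (av S2)" using \<Omega>pos by simp
      moreover have "card (B i \<inter> av S) \<le> card (B i \<inter> av S2)"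
        using S finav by (intro card_mono) (auto simp: av_def)
      then have "4 * D * card (B i \<inter> av S) \<le> 4 * D * card (B i \<inter> av S2)" by simp
      ultimately show ?case using half by linarith
    qed
  qed
  \<comment> \<open>Adding one event to \<open>S\<close> removes at most half of
    \<open>av S\<close>.\<close>
  have "card (av S) > 0" if "S \<subseteq> I" for S
  proof -
    have "finite S" using that fin finite_subset by blast
    then show ?thesis using that
    proof (induction S rule: finite_induct)
      case empty
      then show ?case using \<Omega>pos by (simp add: av_def)
    next
      case (insert i S)
      have "av (insert i S) = av S - (B i \<inter> av S)" by (auto simp: av_def)
      then have c: "card (av (insert i S)) = card (av S) - card (B i \<inter> av S)"
        using finav by (simp add: card_Diff_subset)
      have "2 * card (B i \<inter> av S) \<le> 2 * D * card (B i \<inter> av S)" using D by simp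
      also have "\<dots> \<le> card (av S)" using key insert by auto
      finally show ?case using c insert by auto
    qed
  qed
  then have "av I \<noteq> {}" by fastforce
  then show ?thesis by (auto simp: av_def)
qed

section \<open>Conflict-free colorings\<close>

lemma chi_ON_le:
  assumes "cfon_coloring G f" "finite S" "f ` pverts G \<subseteq> S"
  shows "chi_ON G \<le> enat (card S)"
proof -
  have "chi_ON G \<le> enat (card (f ` pverts G))"
    unfolding chi_ON_def using assms by (intro INF_lower) auto
  also have "\<dots> \<le> enat (card S)" using assms by (simp add: card_mono)
  finally show ?thesis .
qed

section \<open>Vertices with a common neighbor, and the greedy coloring\<close>

context pair_graph
begin

lemma open_neighborhood_subset: "open_neighborhood G v \<subseteq> pverts G"
  by (auto simp: open_neighborhood_def dest: in_arcsD2)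

lemma finite_open_neighborhood: "finite (open_neighborhood G v)"
  using open_neighborhood_subset finite_verts finite_subset by blast

lemma open_neighborhood_sym: "u \<in> open_neighborhood G v \<longleftrightarrow> v \<in> open_neighborhood G u"
  using arcs_symmetric by (auto simp: open_neighborhood_def)

lemma card_open_neighborhood_le: "v \<in> pverts G \<Longrightarrow> card (open_neighborhood G v) \<le> max_degree G"
  unfolding max_degree_def using finite_verts by (intro Max_ge) (auto simp: vertex_degree_def)

text \<open>The union contains all vertices that share a neighbor with \<open>v\<close>. Its size
  bounds both the number of colors excluded in a greedy step and the number of bad events that
  depend on a given one.\<close>

lemma card_second_neighborhood_le:
  assumes "v \<in> pverts G"
  shows "card (\<Union>w\<in>open_neighborhood G v. open_neighborhood G w) \<le> (max_degree G)\<^sup>2"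
proof -
  have "card (\<Union>w\<in>open_neighborhood G v. open_neighborhood G w)
      \<le> (\<Sum>w\<in>open_neighborhood G v. card (open_neighborhood G w))"
    by (intro card_UN_le finite_open_neighborhood)
  also have "\<dots> \<le> (\<Sum>w\<in>open_neighborhood G v. max_degree G)"
    using open_neighborhood_subset by (intro sum_mono card_open_neighborhood_le) auto
  also have "\<dots> \<le> (max_degree G)\<^sup>2"
    using card_open_neighborhood_le[OF assms] by (simp add: power2_eq_square)
  finally show ?thesis .
qed

text \<open>In a greedy coloring a vertex has to differ only from those that share a neighbor with
  it, so at most \<Delta>^2 of the \<Delta>^2 + 1 colors are excluded.\<close>

lemma ex_coloring_inj_on_neighborhoods:
  "\<exists>f :: 'a \<Rightarrow> nat. f ` pverts G \<subseteq> {..(max_degree G)\<^sup>2} \<and>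
     (\<forall>v\<in>pverts G. inj_on f (open_neighborhood G v))"
proof -
  let ?N = "open_neighborhood G" and ?m = "(max_degree G)\<^sup>2"
  have "\<exists>f :: 'a \<Rightarrow> nat. f ` W \<subseteq> {..?m} \<and> (\<forall>v\<in>pverts G. inj_on f (?N v \<inter> W))"
    if "finite W" "W \<subseteq> pverts G" for W
    using that
  proof (induction W rule: finite_induct)
    case empty
    then show ?case by simp
  next
    case (insert x W)
    then obtain f :: "'a \<Rightarrow> nat" where f: "f ` W \<subseteq> {..?m}" "\<forall>v\<in>pverts G. inj_on f (?N v \<inter> W)"
      by auto
    let ?F = "\<Union>w\<in>?N x. ?N w"
    have finF: "finite ?F" using finite_open_neighborhood by auto
    \<comment> \<open>\<open>f\<close> is total, so its values at uncolored vertices, possibly at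
      \<open>x\<close> itself, are excluded as well; the count allows for that.\<close>
    have "card (f ` ?F) \<le> ?m"
      using card_second_neighborhood_le[of x] insert.prems card_image_le[OF finF, of f] by simp
    then have "\<not> {..?m} \<subseteq> f ` ?F"
      using card_mono[of "f ` ?F" "{..?m}"] finF by auto
    then obtain s where s: "s \<le> ?m" "s \<notin> f ` ?F" by auto
    have "inj_on (f(x := s)) (?N v \<inter> insert x W)" if v: "v \<in> pverts G" for v
    proof (cases "x \<in> ?N v")
      case True
      then have "v \<in> ?N x" by (simp add: open_neighborhood_sym)
      then have "s \<notin> f ` ?N v" using s by auto
      then have "inj_on f (?N v \<inter> W)" "s \<notin> f ` (?N v \<inter> W)" using f v by auto
      then show ?thesis using True insert.hyps
        by (auto simp: inj_on_def)
    next
      case False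
      then have "?N v \<inter> insert x W = ?N v \<inter> W" by auto
      then show ?thesis using f v insert.hyps False by (auto simp: inj_on_def)
    qed
    moreover have "(f(x := s)) ` insert x W \<subseteq> {..?m}" using f s by auto
    ultimately show ?case by blast
  qed
  from this[of "pverts G"] show ?thesis
    using finite_verts open_neighborhood_subset by (auto simp: Int_absorb2)
qed

text \<open>Injectivity makes each color in a nonempty neighborhood unique. This handles the graphs
  whose maximum degree is bounded by a constant.\<close>

lemma chi_ON_le_max_degree_sq:
  assumes "\<And>v. v \<in> pverts G \<Longrightarrow> open_neighborhood G v \<noteq> {}"
  shows "chi_ON G \<le> enat ((max_degree G)\<^sup>2 + 1)"
proof -
  obtain f :: "'a \<Rightarrow> nat" where f: "f ` pverts G \<subseteq> {..(max_degree G)\<^sup>2}"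
    "\<And>v. v \<in> pverts G \<Longrightarrow> inj_on f (open_neighborhood G v)"
    using ex_coloring_inj_on_neighborhoods by blast
  have "cfon_coloring G f"
    unfolding cfon_coloring_def
  proof
    fix v assume v: "v \<in> pverts G"
    then obtain w where "w \<in> open_neighborhood G v" using assms by blast
    then have "\<exists>!w'. w' \<in> open_neighborhood G v \<and> f w' = f w"
      using f(2)[OF v] by (auto simp: inj_on_def)
    then show "\<exists>c. \<exists>!w. w \<in> open_neighborhood G v \<and> f w = c" by blast
  qed
  from chi_ON_le[OF this _ f(1)] show ?thesis by simp
qed

section \<open>Random coloring with \<open>k\<close> kept colors\<close>

text \<open>The hypothesis \<open>small\<close> is the condition 4 D p <= 1 of the local lemma, with
  D = \<Delta>^2 and with the bound from word counting in place of p.\<close>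

lemma chi_ON_le_special_colors:
  assumes ne: "\<And>v. v \<in> pverts G \<Longrightarrow> open_neighborhood G v \<noteq> {}"
    and \<Delta>: "max_degree G \<ge> 1" and k: "k \<le> max_degree G"
    and small: "\<And>n. n \<in> vertex_degree G ` pverts G \<Longrightarrow>
      4 * (max_degree G)\<^sup>2 * (exp 1 * n * exp (- (real k * n / (max_degree G * exp 1)))) \<le> 1"
  shows "chi_ON G \<le> enat (k + 1)"
proof -
  let ?N = "open_neighborhood G"
  define M where "M = max_degree G"
  define \<Omega> where "\<Omega> = pverts G \<rightarrow>\<^sub>E {..<M}"
  define B where "B v = {f \<in> \<Omega>. no_unique (?N v) {..<k} f}" for v
  have "\<exists>f\<in>\<Omega>. \<forall>v\<in>pverts G. f \<notin> B v"
    unfolding \<Omega>_def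
  proof (rule local_lemma[where N = ?N and D = "M\<^sup>2"])
    show "finite (pverts G)" "finite (pverts G)" by simp_all
    show "finite {..<M}" "{..<M} \<noteq> {}" "1 \<le> M\<^sup>2"
      using \<Delta> by (auto simp: M_def lessThan_empty_iff)
  next
    fix v assume v: "v \<in> pverts G"
    show "B v \<subseteq> pverts G \<rightarrow>\<^sub>E {..<M}" by (auto simp: B_def \<Omega>_def)
    have "no_unique (?N v) {..<k} g" if "no_unique (?N v) {..<k} f" "\<forall>x\<in>?N v. f x = g x" for f g
    proof -
      have "{x \<in> ?N v. f x = s} = {x \<in> ?N v. g x = s}" for s using that by auto
      then show ?thesis using that by (simp add: no_unique_def)
    qed
    then show "determined_by (?N v) (pverts G \<rightarrow>\<^sub>E {..<M}) (B v)"
      by (auto simp: determined_by_def B_def \<Omega>_def)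
    have "{u \<in> pverts G. ?N u \<inter> ?N v \<noteq> {}} \<subseteq> (\<Union>w\<in>?N v. ?N w)"
      using open_neighborhood_sym by blast
    then have "card {u \<in> pverts G. ?N u \<inter> ?N v \<noteq> {}} \<le> card (\<Union>w\<in>?N v. ?N w)"
      using finite_open_neighborhood by (intro card_mono) auto
    then show "card {u \<in> pverts G. ?N u \<inter> ?N v \<noteq> {}} \<le> M\<^sup>2"
      using card_second_neighborhood_le[OF v] by (simp add: M_def)
    let ?T = "{f \<in> ?N v \<rightarrow>\<^sub>E {..<M}. no_unique (?N v) {..<k} f}"
    let ?R = "(pverts G - ?N v) \<rightarrow>\<^sub>E {..<M}"
    let ?n = "card (?N v)"
    \<comment> \<open>Outside the neighborhood the colors are free, so the share of
      \<open>B v\<close> in \<open>\<Omega>\<close> is at most that of \<open>?T\<close> among all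
      colorings of the neighborhood.\<close>
    define \<phi> where "\<phi> f = (restrict f (?N v), restrict f (pverts G - ?N v))" for f :: "'a \<Rightarrow> nat"
    have "inj_on \<phi> (B v)"
    proof (rule inj_onI)
      fix f g assume fg: "f \<in> B v" "g \<in> B v" "\<phi> f = \<phi> g"
      show "f = g"
      proof
        fix x
        have "restrict f (?N v) x = restrict g (?N v) x"
          "restrict f (pverts G - ?N v) x = restrict g (pverts G - ?N v) x"
          using fg by (simp_all add: \<phi>_def)
        then show "f x = g x"
          using fg by (auto simp: B_def \<Omega>_def PiE_def extensional_def restrict_def split: if_splits)
      qed
    qed
    moreover have "\<phi> ` B v \<subseteq> ?T \<times> ?R"
    proof -
      have "no_unique (?N v) {..<k} (restrict f (?N v))" if "f \<in> B v" for f
      proof -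
        have "{x \<in> ?N v. restrict f (?N v) x = s} = {x \<in> ?N v. f x = s}" for s by auto
        then show ?thesis using that by (simp add: no_unique_def B_def)
      qed
      then show ?thesis
        using open_neighborhood_subset[of v] by (auto simp: \<phi>_def B_def \<Omega>_def PiE_def Pi_def)
    qed
    moreover have "finite (?T \<times> ?R)"
      by (intro finite_cartesian_product finite_Collect_conjI disjI1)
        (auto intro!: finite_PiE finite_open_neighborhood)
    ultimately have "card (B v) \<le> card (?T \<times> ?R)"
      by (rule card_inj_on_le)
    also have "\<dots> = card ?T * M ^ (card (pverts G) - ?n)"
      using open_neighborhood_subset[of v] finite_open_neighborhood[of v]
      by (simp add: card_cartesian_product card_funcsetE card_Diff_subset)
    finally have "real (card (B v)) \<le> card ?T * M ^ (card (pverts G) - ?n)"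
      by (metis of_nat_le_iff)
    also have "\<dots> \<le> (real M ^ ?n * (exp 1 * ?n * exp (- (real k * ?n / (M * exp 1)))))
        * M ^ (card (pverts G) - ?n)"
      using ne[OF v] k card_open_neighborhood_le[OF v] finite_open_neighborhood
        card_no_unique_le_uniform[of "?N v" M k]
      by (simp add: M_def mult_right_mono)
    also have "\<dots> = (exp 1 * ?n * exp (- (real k * ?n / (M * exp 1)))) * real M ^ (?n + (card (pverts G) - ?n))"
      by (simp only: power_add of_nat_power mult_ac)
    also have "?n + (card (pverts G) - ?n) = card (pverts G)"
      using open_neighborhood_subset[of v] by (simp add: card_mono)
    finally have "real (4 * M\<^sup>2) * card (B v) \<le>
        real (4 * M\<^sup>2) * ((exp 1 * ?n * exp (- (real k * ?n / (M * exp 1)))) * real M ^ card (pverts G))"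
      by (intro mult_left_mono) auto
    also have "\<dots> = (4 * M\<^sup>2 * (exp 1 * ?n * exp (- (real k * ?n / (M * exp 1))))) * real M ^ card (pverts G)"
      by simp
    also have "\<dots> \<le> 1 * real M ^ card (pverts G)"
      using small[of ?n] v by (intro mult_right_mono) (auto simp: M_def vertex_degree_def)
    finally have "real (4 * M\<^sup>2 * card (B v)) \<le> real (M ^ card (pverts G))" by simp
    then show "4 * M\<^sup>2 * card (B v) \<le> card (pverts G \<rightarrow>\<^sub>E {..<M})"
      by (simp only: of_nat_le_iff card_funcsetE finite_verts card_lessThan)
  qed
  then obtain f where f: "f \<in> \<Omega>" "\<And>v. v \<in> pverts G \<Longrightarrow> f \<notin> B v" by blast
  \<comment> \<open>The raw colors from \<open>k\<close> on become the dummy color \<open>k\<close>;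
    each color below \<open>k\<close> keeps its class, so a unique occurrence survives.\<close>
  define g where "g x = min (f x) k" for x
  have "cfon_coloring G g"
    unfolding cfon_coloring_def
  proof
    fix v assume "v \<in> pverts G"
    then obtain s where s: "s < k" "card {x \<in> ?N v. f x = s} = 1"
      using f by (auto simp: B_def no_unique_def)
    then obtain w where w: "{x \<in> ?N v. f x = s} = {w}" by (auto simp: card_1_singleton_iff)
    have "g x = s \<longleftrightarrow> f x = s" for x using s by (auto simp: g_def min_def)
    then have "x \<in> ?N v \<and> g x = s \<longleftrightarrow> x = w" for x using w by (auto simp: set_eq_iff)
    then have "\<exists>!w. w \<in> ?N v \<and> g w = s" by simp
    then show "\<exists>c. \<exists>!w. w \<in> ?N v \<and> g w = c" by blast
  qed
  moreover have "g ` pverts G \<subseteq> {..k}" by (auto simp: g_def)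
  ultimately have "chi_ON G \<le> enat (card {..k})" by (intro chi_ON_le) auto
  then show ?thesis by simp
qed

end

section \<open>Choice of the constants\<close>

theorem theorem5:
  fixes c \<epsilon> :: real
  assumes "c > 0" and "\<epsilon> \<ge> 0"
  shows "\<exists>C > 0. \<forall>(G :: 'a pair_pre_digraph) (\<Delta> :: nat).
           pair_graph G \<longrightarrow> max_degree G = \<Delta> \<longrightarrow> \<Delta> \<ge> 2 \<longrightarrow>
           (\<forall>v \<in> pverts G. real (vertex_degree G v) \<ge> c * real \<Delta> / (ln (real \<Delta>)) powr \<epsilon>) \<longrightarrow>
           ereal_of_enat (chi_ON G) \<le> ereal (C * (ln (real \<Delta>)) powr (1 + \<epsilon>))"
proof -
  \<comment> \<open>This \<open>a\<close> makes k n / (e \<Delta>) at least 7 ln \<Delta>. The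
    resulting \<Delta>^(-7) outweighs the factor 4 \<Delta>^2 of the local lemma and the factor e
    \<Delta> of the counting bound already for \<Delta> = 2.\<close>
  define a where "a = 7 * exp 1 / c"
  have a: "a > 0" using assms by (simp add: a_def)
  \<comment> \<open>The kept colors must be among the \<Delta> raw ones; from \<open>n0\<close> on
    there is room for them.\<close>
  have "((\<lambda>x :: real. (a * ln x powr (1 + \<epsilon>) + 1) / x) \<longlongrightarrow> 0) at_top"
    using assms a by real_asymp
  then have "eventually (\<lambda>x :: real. (a * ln x powr (1 + \<epsilon>) + 1) / x < 1) at_top"
    by (rule order_tendstoD) simp
  then have "eventually (\<lambda>n :: nat. (a * ln (real n) powr (1 + \<epsilon>) + 1) / n < 1) sequentially"
    by (rule eventually_compose_filterlim[OF _ filterlim_real_sequentially])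
  then obtain n0 where n0: "\<And>n. n \<ge> n0 \<Longrightarrow> (a * ln (real n) powr (1 + \<epsilon>) + 1) / n < 1"
    by (auto simp: eventually_sequentially)
  define l where "l = ln 2 powr (1 + \<epsilon>)"
  have l: "l > 0" by (simp add: l_def)
  \<comment> \<open>\<open>n0\<close>^2 + 2 covers the greedy bound \<Delta>^2 + 1 below
    \<open>n0\<close>, and otherwise one unit for rounding up and one for the dummy color. As
    \<Delta> \<ge> 2, the logarithmic factor is at least \<open>l\<close>, so this constant is
    absorbed after division by \<open>l\<close>.\<close>
  define C where "C = a + (real n0 ^ 2 + 2) / l"
  have C: "C > 0" using a l by (auto simp: C_def intro!: add_pos_nonneg)
  show ?thesis
  proof (intro exI[of _ C] conjI allI impI C)
    fix G :: "'a pair_pre_digraph" and \<Delta> :: nat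
    assume G: "pair_graph G" and max: "max_degree G = \<Delta>" and \<Delta>: "\<Delta> \<ge> 2"
      and deg: "\<forall>v \<in> pverts G. real (vertex_degree G v) \<ge> c * real \<Delta> / ln (real \<Delta>) powr \<epsilon>"
    interpret pair_graph G by fact
    let ?L = "ln (real \<Delta>) powr (1 + \<epsilon>)"
    have ln: "ln (real \<Delta>) \<ge> ln 2" using \<Delta> by simp
    moreover have "ln 2 > (0 :: real)" by simp
    ultimately have lnpos: "ln (real \<Delta>) > 0" by linarith
    have L: "?L \<ge> l" unfolding l_def using ln assms by (intro powr_mono2) auto
    \<comment> \<open>An isolated vertex would make \<open>chi_ON\<close> infinite; the degree bound
      excludes it by being positive.\<close>
    have ne: "open_neighborhood G v \<noteq> {}" if "v \<in> pverts G" for v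
    proof -
      have "c * real \<Delta> / ln (real \<Delta>) powr \<epsilon> > 0" using assms \<Delta> lnpos by simp
      then have "real (vertex_degree G v) > 0" using deg that by force
      then show ?thesis by (auto simp: vertex_degree_def)
    qed
    have "\<exists>m. chi_ON G \<le> enat m \<and> real m \<le> a * ?L + (real n0 ^ 2 + 2)"
    proof (cases "\<Delta> \<ge> n0")
      case False
      then have "real \<Delta> ^ 2 \<le> real n0 ^ 2" by (intro power_mono) auto
      moreover have "a * ?L \<ge> 0" using a by simp
      ultimately have "real (\<Delta>\<^sup>2 + 1) \<le> a * ?L + (real n0 ^ 2 + 2)"
        unfolding of_nat_add of_nat_power of_nat_1 by linarith
      then show ?thesis using chi_ON_le_max_degree_sq ne max by blast
    next
      case True
      define k where "k = nat \<lceil>a * ?L\<rceil>"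
      have aL: "a * ?L \<ge> 0" using a by simp
      then have "real k = of_int \<lceil>a * ?L\<rceil>" by (simp add: k_def)
      then have k: "real k \<ge> a * ?L" "real k \<le> a * ?L + 1" by linarith+
      have "a * ?L + 1 < \<Delta>" using n0[OF True] \<Delta> by (simp add: field_simps)
      then have kM: "k \<le> \<Delta>" using k by linarith
      have "4 * \<Delta>\<^sup>2 * (exp 1 * n * exp (- (real k * n / (\<Delta> * exp 1)))) \<le> 1"
        if n: "n \<in> vertex_degree G ` pverts G" for n
      proof -
        have n\<Delta>: "n \<le> \<Delta>" using n card_open_neighborhood_le max by (auto simp: vertex_degree_def)
        \<comment> \<open>The powers 1 + \<epsilon> and - \<epsilon> of the logarithm combine to ln
          \<Delta>, and \<open>c\<close> cancels; this is the source of the exponent 1 +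
          \<epsilon>.\<close>
        have "7 * ln \<Delta> * (\<Delta> * exp 1) = (a * ?L) * (c * real \<Delta> / ln (real \<Delta>) powr \<epsilon>)"
          using assms lnpos by (simp add: a_def powr_add)
        also have "\<dots> \<le> real k * n"
          using k deg n assms aL by (intro mult_mono) auto
        finally have "7 * ln \<Delta> \<le> real k * n / (\<Delta> * exp 1)"
          using \<Delta> by (simp add: field_simps)
        then have "exp (- (real k * n / (\<Delta> * exp 1))) \<le> exp (- (7 * ln \<Delta>))" by simp
        also have "\<dots> = 1 / real \<Delta> ^ 7"
          using \<Delta> exp_of_nat_mult[of 7 "ln (real \<Delta>)"] by (simp add: exp_minus field_simps)
        finally have "4 * \<Delta>\<^sup>2 * (exp 1 * n * exp (- (real k * n / (\<Delta> * exp 1))))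
            \<le> 4 * \<Delta>\<^sup>2 * (3 * real \<Delta> * (1 / real \<Delta> ^ 7))"
          using n\<Delta> exp_le by (intro mult_mono mult_nonneg_nonneg) auto
        also have "\<dots> = 12 / real \<Delta> ^ 4"
          using \<Delta> by (simp add: field_simps eval_nat_numeral)
        also have "\<dots> \<le> 1"
          using power_mono[of 2 "real \<Delta>" 4] \<Delta> by simp
        finally show ?thesis .
      qed
      then have "chi_ON G \<le> enat (k + 1)"
        using ne kM \<Delta> max by (intro chi_ON_le_special_colors) auto
      moreover have "real (k + 1) \<le> a * ?L + (real n0 ^ 2 + 2)"
        unfolding of_nat_add of_nat_1 using k zero_le_power2[of "real n0"] by linarith
      ultimately show ?thesis by blast
    qed
    then obtain m where m: "chi_ON G \<le> enat m" "real m \<le> a * ?L + (real n0 ^ 2 + 2)" by blast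
    have "real n0 ^ 2 + 2 = (real n0 ^ 2 + 2) / l * l" using l by simp
    also have "\<dots> \<le> (real n0 ^ 2 + 2) / l * ?L" using L l by (intro mult_left_mono) auto
    finally have "real m \<le> C * ?L" using m by (simp add: C_def algebra_simps)
    moreover have "ereal_of_enat (chi_ON G) \<le> ereal (real m)"
      using m by (metis ereal_of_enat_le_iff ereal_of_enat_simps(1))
    ultimately show "ereal_of_enat (chi_ON G) \<le> ereal (C * ?L)"
      by (meson ereal_less_eq(3) order_trans)
  qed
qed

end
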